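(* Let $\mathbf P=(P,\leq,{}',0,1)$ be a bounded poset with a unary operation and let $\mathbf L=(P,\sqcup,\sqcap,{}',0,1)$ be a $\lambda$-lattice assigned to $\mathbf P$. Then $\mathbf P$ is skew-orthomodular if and only if $\mathbf L$ satisfies the five identities $$(x\sqcup y)\sqcup(x'\sqcup y)\approx 1,$$ $$(x\sqcap y)\sqcap(x'\sqcap y)\approx 0,$$ $$(((x\sqcap y')\sqcup z)\sqcup(y\sqcup z))\sqcap((x\sqcap y')\sqcup y)\approx(x\sqcap y')\sqcup y,$$ $$(((x\sqcap y)'\sqcap z)\sqcap(y\sqcap z))\sqcup((x\sqcap y)'\sqcap y)\approx(x\sqcap y)'\sqcap y,$$ $$x\sqcup(x'\sqcap(x\sqcup y))\approx x\sqcup y .$$ Hence $\mathcal{L}s$, the class of all bounded $\lambda$-lattices $\mathbf L$ with a unary operation whose induced poset $\mathbb P(\mathbf L)$ is skew-orthomodular, is a variety.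
   Context: A bounded poset with a unary operation is a structure $\mathbf P=(P,\leq,{}',0,1)$ where $(P,\leq)$ is a poset with least element $0$ and greatest element $1$ and ${}'$ is an arbitrary unary operation on $P$. For $a,b\in P$, $a\vee b$ denotes $\sup(a,b)$ and $a\wedge b$ denotes $\inf(a,b)$, whenever these exist; $U(a,b)=\{x\in P\mid a,b\leq x\}$ and $L(a,b)=\{x\in P\mid x\leq a,b\}$. $\mathbf P$ is complemented if for every $x\in P$ the elements $x\vee x'$ and $x\wedge x'$ exist with $x\vee x'=1$ and $x\wedge x'=0$. A complemented poset is orthogonal if $x\vee y$ exists for all $x,y\in P$ with $x\leq y'$. An orthogonal poset is almost skew-orthomodular if $x\vee(x'\wedge y)$ exists (i.e. $x'\wedge y$ exists and its join with $x$ exists) for all $x,y\in P$ with $x\leq y$. An almost skew-orthomodular poset is skew-orthomodular if $x\vee(x'\wedge y)=y$ for all $x,y\in P$ with $x\leq y$. A bounded $\lambda$-lattice is an algebra $(L,\sqcup,\sqcap,0,1)$ of type $(2,2,0,0)$ satisfying the identities $x\sqcup y\approx y\sqcup x$, $x\sqcap y\approx y\sqcap x$, $x\sqcup((x\sqcup y)\sqcup z)\approx(x\sqcup y)\sqcup z$, $x\sqcap((x\sqcap y)\sqcap z)\approx(x\sqcap y)\sqcap z$, $x\sqcup(x\sqcap y)\approx x$, $x\sqcap(x\sqcup y)\approx x$, $x\sqcup0\approx x$, $x\sqcup1\approx1$. A bounded $\lambda$-lattice with a unary operation is an algebra $\mathbf L=(L,\sqcup,\sqcap,{}',0,1)$ such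 that $(L,\sqcup,\sqcap,0,1)$ is a bounded $\lambda$-lattice and ${}'$ is a unary operation on $L$. Its induced bounded poset with a unary operation is $\mathbb P(\mathbf L)=(L,\leq,{}',0,1)$, where $x\leq y$ if and only if $x\sqcup y=y$. A $\lambda$-lattice assigned to a bounded poset $\mathbf P=(P,\leq,{}',0,1)$ with a unary operation is any algebra $(P,\sqcup,\sqcap,{}',0,1)$ (with the same ${}',0,1$) such that for all $x,y\in P$: if $x\vee y$ exists then $x\sqcup y=x\vee y$, otherwise $x\sqcup y=y\sqcup x$ is an arbitrarily chosen element of $U(x,y)$; if $x\wedge y$ exists then $x\sqcap y=x\wedge y$, otherwise $x\sqcap y=y\sqcap x$ is an arbitrarily chosen element of $L(x,y)$. It is a bounded $\lambda$-lattice with a unary operation.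
   Formalization: The class in the last sentence is not a variety as defined (not closed under subalgebras); it is restricted to those L where x⊔y equals x∨y whenever x≤y' and the join exists, and x'⊓y equals x'∧y whenever x≤y and the meet exists. *)

theory Defs
  imports "HOL-Algebra.Order"
begin

text \<open>Posets with a bottom, a top and a unary operation. The operation is only
  meaningful on the carrier and is not required to be antitone or an involution.\<close>

record 'a uposet = "'a gorder" +
  pcompl :: "'a \<Rightarrow> 'a"
  pzero :: 'a
  pone :: 'a

locale bounded_uposet = partial_order P
  for P :: "('a, 'b) uposet_scheme" (structure) +
  assumes pcompl_closed: "x \<in> carrier P \<Longrightarrow> pcompl P x \<in> carrier P"
    and pzero_least: "least P (pzero P) (carrier P)"
    and pone_greatest: "greatest P (pone P) (carrier P)"

text \<open>Joins and meets are partial, so they are relations: \<open>is_join P s x y\<close> reads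
  ``the join of \<open>x\<close> and \<open>y\<close> exists and equals \<open>s\<close>''.\<close>

definition is_join :: "('a, 'b) gorder_scheme \<Rightarrow> 'a \<Rightarrow> 'a \<Rightarrow> 'a \<Rightarrow> bool" where
  "is_join P s x y \<longleftrightarrow> least P s (Upper P {x, y})"

definition is_meet :: "('a, 'b) gorder_scheme \<Rightarrow> 'a \<Rightarrow> 'a \<Rightarrow> 'a \<Rightarrow> bool" where
  "is_meet P m x y \<longleftrightarrow> greatest P m (Lower P {x, y})"

locale complemented_uposet = bounded_uposet +
  assumes join_compl: "x \<in> carrier P \<Longrightarrow> is_join P (pone P) x (pcompl P x)"
    and meet_compl: "x \<in> carrier P \<Longrightarrow> is_meet P (pzero P) x (pcompl P x)"

locale orthogonal_uposet = complemented_uposet +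
  assumes orthogonal_join:
    "\<lbrakk>x \<in> carrier P; y \<in> carrier P; x \<sqsubseteq> pcompl P y\<rbrakk> \<Longrightarrow> \<exists>s. is_join P s x y"

locale almost_skew_orthomodular_uposet = orthogonal_uposet +
  assumes almost_skew_orthomodular:
    "\<lbrakk>x \<in> carrier P; y \<in> carrier P; x \<sqsubseteq> y\<rbrakk>
      \<Longrightarrow> \<exists>m. is_meet P m (pcompl P x) y \<and> (\<exists>s. is_join P s x m)"

locale skew_orthomodular_uposet = almost_skew_orthomodular_uposet +
  assumes skew_orthomodular:
    "\<lbrakk>x \<in> carrier P; y \<in> carrier P; x \<sqsubseteq> y;
      is_meet P m (pcompl P x) y; is_join P s x m\<rbrakk> \<Longrightarrow> s = y"

record 'a ulattice = "'a partial_object" +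
  ljoin :: "'a \<Rightarrow> 'a \<Rightarrow> 'a" (infixl \<open>\<squnion>\<index>\<close> 65)
  lmeet :: "'a \<Rightarrow> 'a \<Rightarrow> 'a" (infixl \<open>\<sqinter>\<index>\<close> 70)
  lcompl :: "'a \<Rightarrow> 'a" (\<open>\<sim>\<index> _\<close> [81] 80)
  lzero :: 'a (\<open>\<zero>\<index>\<close>)
  lone :: 'a (\<open>\<one>\<index>\<close>)

text \<open>Algebras of type \<open>(2, 2, 1, 0, 0)\<close>\<close>

locale ualgebra =
  fixes L :: "('a, 'b) ulattice_scheme" (structure)
  assumes ljoin_closed: "\<lbrakk>x \<in> carrier L; y \<in> carrier L\<rbrakk> \<Longrightarrow> x \<squnion> y \<in> carrier L"
    and lmeet_closed: "\<lbrakk>x \<in> carrier L; y \<in> carrier L\<rbrakk> \<Longrightarrow> x \<sqinter> y \<in> carrier L"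
    and lcompl_closed: "x \<in> carrier L \<Longrightarrow> \<sim> x \<in> carrier L"
    and lzero_closed: "\<zero> \<in> carrier L"
    and lone_closed: "\<one> \<in> carrier L"

locale bounded_lambda_ulattice = ualgebra +
  assumes ljoin_comm: "\<lbrakk>x \<in> carrier L; y \<in> carrier L\<rbrakk> \<Longrightarrow> x \<squnion> y = y \<squnion> x"
    and lmeet_comm: "\<lbrakk>x \<in> carrier L; y \<in> carrier L\<rbrakk> \<Longrightarrow> x \<sqinter> y = y \<sqinter> x"
    and ljoin_skew_assoc: "\<lbrakk>x \<in> carrier L; y \<in> carrier L; z \<in> carrier L\<rbrakk>
      \<Longrightarrow> x \<squnion> ((x \<squnion> y) \<squnion> z) = (x \<squnion> y) \<squnion> z"
    and lmeet_skew_assoc: "\<lbrakk>x \<in> carrier L; y \<in> carrier L; z \<in> carrier L\<rbrakk>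
      \<Longrightarrow> x \<sqinter> ((x \<sqinter> y) \<sqinter> z) = (x \<sqinter> y) \<sqinter> z"
    and ljoin_absorb: "\<lbrakk>x \<in> carrier L; y \<in> carrier L\<rbrakk> \<Longrightarrow> x \<squnion> (x \<sqinter> y) = x"
    and lmeet_absorb: "\<lbrakk>x \<in> carrier L; y \<in> carrier L\<rbrakk> \<Longrightarrow> x \<sqinter> (x \<squnion> y) = x"
    and ljoin_lzero: "x \<in> carrier L \<Longrightarrow> x \<squnion> \<zero> = x"
    and ljoin_lone: "x \<in> carrier L \<Longrightarrow> x \<squnion> \<one> = \<one>"

definition induced_uposet :: "('a, 'b) ulattice_scheme \<Rightarrow> 'a uposet" where
  "induced_uposet L =
    \<lparr> carrier = carrier L, eq = (=), le = (\<lambda>x y. x \<squnion>\<^bsub>L\<^esub> y = y),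
      pcompl = lcompl L, pzero = \<zero>\<^bsub>L\<^esub>, pone = \<one>\<^bsub>L\<^esub> \<rparr>"

text \<open>\<open>assigned_lambda_lattice P L\<close>: \<open>L\<close> is one of the \<open>\<lambda>\<close>-lattices assigned to \<open>P\<close>.\<close>

locale assigned_lambda_lattice =
  fixes P :: "('a, 'b) uposet_scheme" and L :: "('a, 'c) ulattice_scheme" (structure)
  assumes carrier_eq: "carrier L = carrier P"
    and lcompl_eq: "x \<in> carrier P \<Longrightarrow> \<sim> x = pcompl P x"
    and lzero_eq: "\<zero> = pzero P"
    and lone_eq: "\<one> = pone P"
    and ljoin_exists: "\<lbrakk>x \<in> carrier P; y \<in> carrier P; is_join P s x y\<rbrakk> \<Longrightarrow> x \<squnion> y = s"
    and ljoin_choice: "\<lbrakk>x \<in> carrier P; y \<in> carrier P; \<nexists>s. is_join P s x y\<rbrakk>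
      \<Longrightarrow> x \<squnion> y = y \<squnion> x \<and> x \<squnion> y \<in> Upper P {x, y}"
    and lmeet_exists: "\<lbrakk>x \<in> carrier P; y \<in> carrier P; is_meet P m x y\<rbrakk> \<Longrightarrow> x \<sqinter> y = m"
    and lmeet_choice: "\<lbrakk>x \<in> carrier P; y \<in> carrier P; \<nexists>m. is_meet P m x y\<rbrakk>
      \<Longrightarrow> x \<sqinter> y = y \<sqinter> x \<and> x \<sqinter> y \<in> Lower P {x, y}"

datatype uterm = Var nat | Join uterm uterm | Meet uterm uterm | Compl uterm | Zero | One

primrec term_val :: "('a, 'b) ulattice_scheme \<Rightarrow> (nat \<Rightarrow> 'a) \<Rightarrow> uterm \<Rightarrow> 'a" where
  "term_val L v (Var i) = v i"
| "term_val L v (Join s t) = term_val L v s \<squnion>\<^bsub>L\<^esub> term_val L v t"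
| "term_val L v (Meet s t) = term_val L v s \<sqinter>\<^bsub>L\<^esub> term_val L v t"
| "term_val L v (Compl t) = \<sim>\<^bsub>L\<^esub> term_val L v t"
| "term_val L v Zero = \<zero>\<^bsub>L\<^esub>"
| "term_val L v One = \<one>\<^bsub>L\<^esub>"

definition satisfies_identity :: "('a, 'b) ulattice_scheme \<Rightarrow> uterm \<times> uterm \<Rightarrow> bool" where
  "satisfies_identity L e \<longleftrightarrow>
    (\<forall>v. range v \<subseteq> carrier L \<longrightarrow> term_val L v (fst e) = term_val L v (snd e))"

definition models :: "(uterm \<times> uterm) set \<Rightarrow> 'a ulattice set" where
  "models E = {L. ualgebra L \<and> (\<forall>e\<in>E. satisfies_identity L e)}"

text \<open>A variety is the class of all algebras satisfying some set of identities. A class of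
  algebras is given by its members with carriers in a type, for every type. Types cannot be
  quantified inside a formula, so \<open>K\<close> and \<open>K'\<close> are the class taken at two arbitrary types,
  and a single set of identities has to define both.\<close>

definition variety :: "'a ulattice set \<Rightarrow> 'b ulattice set \<Rightarrow> bool" where
  "variety K K' \<longleftrightarrow> (\<exists>E. K = models E \<and> K' = models E)"

text \<open>The induced order does not determine the operations of a \<open>\<lambda>\<close>-lattice: \<open>x \<squnion> y\<close> may be
  strictly above an existing join. As for assigned \<open>\<lambda>\<close>-lattices, the operations must give the
  joins and meets that exist, here those whose existence is part of the definition of a
  skew-orthomodular poset. Without this the class is not a variety: on the Boolean algebra of
  subsets of \<open>{a, b, c}\<close> let \<open>x \<squnion> y\<close> be the top and \<open>x \<sqinter> y\<close> the bottom for all incomparable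
  \<open>x\<close>, \<open>y\<close>. The induced poset is unchanged, hence skew-orthomodular, but the subalgebra consisting
  of \<open>\<emptyset>\<close>, \<open>{a}\<close>, \<open>{b}\<close> and their complements induces a poset which is not.
  Requiring agreement for all existing joins and meets does not give a variety either.\<close>

locale orthogonally_compatible =
  fixes L :: "('a, 'b) ulattice_scheme" (structure)
  assumes compatible_join:
    "\<lbrakk>x \<in> carrier L; y \<in> carrier L; le (induced_uposet L) x (\<sim> y); is_join (induced_uposet L) s x y\<rbrakk>
      \<Longrightarrow> x \<squnion> y = s"
    and compatible_meet:
    "\<lbrakk>x \<in> carrier L; y \<in> carrier L; le (induced_uposet L) x y; is_meet (induced_uposet L) m (\<sim> x) y\<rbrakk>
      \<Longrightarrow> \<sim> x \<sqinter> y = m"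

definition skew_orthomodular_lambda_lattices :: "'a ulattice set" where
  "skew_orthomodular_lambda_lattices =
    {L. bounded_lambda_ulattice L \<and> skew_orthomodular_uposet (induced_uposet L) \<and>
        orthogonally_compatible L}"

lemma assigned_in_skew_orthomodular_lambda_lattices:
  assumes L: "bounded_lambda_ulattice L" and skew: "skew_orthomodular_uposet (induced_uposet L)"
    and assigned: "assigned_lambda_lattice (induced_uposet L) L"
  shows "L \<in> skew_orthomodular_lambda_lattices"
proof -
  interpret L: bounded_lambda_ulattice L by (fact L)
  interpret A: assigned_lambda_lattice "induced_uposet L" L by (fact assigned)
  have carrier: "carrier (induced_uposet L) = carrier L"
    by (simp add: induced_uposet_def)
  have "orthogonally_compatible L"
  proof
    show "x \<squnion>\<^bsub>L\<^esub> y = s"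
      if "x \<in> carrier L" "y \<in> carrier L" "is_join (induced_uposet L) s x y" for x y s
      by (rule A.ljoin_exists) (simp_all only: carrier that)
    show "\<sim>\<^bsub>L\<^esub> x \<sqinter>\<^bsub>L\<^esub> y = m"
      if "x \<in> carrier L" "y \<in> carrier L" "is_meet (induced_uposet L) m (\<sim>\<^bsub>L\<^esub> x) y" for x y m
      by (rule A.lmeet_exists) (simp_all only: carrier that L.lcompl_closed)
  qed
  with L skew show ?thesis by (simp add: skew_orthomodular_lambda_lattices_def)
qed

end

theory Submission
  imports Defs
begin

text \<open>The value of \<open>s \<squnion> t\<close> is the join of \<open>s\<close> and \<open>t\<close> iff it lies below every \<open>z\<close> in \<open>U(s, t)\<close>, and
  the elements \<open>(s \<squnion> z) \<squnion> (t \<squnion> z)\<close> lie in \<open>U(s, t)\<close> and, for \<open>z \<in> U(s, t)\<close>, equal \<open>z\<close>.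
  Hence \<open>((s \<squnion> z) \<squnion> (t \<squnion> z)) \<sqinter> (s \<squnion> t) \<approx> s \<squnion> t\<close> says that \<open>s \<squnion> t\<close> is the join. Substituting
  \<open>x \<sqinter> y'\<close> for \<open>s\<close> and \<open>y\<close> for \<open>t\<close> restricts this to the pairs with \<open>s \<le> t'\<close>, and dually for meets.\<close>

definition skew_orthomodular_identities :: "('a, 'm) ulattice_scheme \<Rightarrow> bool" where
  "skew_orthomodular_identities L \<longleftrightarrow>
    (\<forall>x\<in>carrier L. \<forall>y\<in>carrier L. (x \<squnion>\<^bsub>L\<^esub> y) \<squnion>\<^bsub>L\<^esub> (\<sim>\<^bsub>L\<^esub> x \<squnion>\<^bsub>L\<^esub> y) = \<one>\<^bsub>L\<^esub>) \<and>
    (\<forall>x\<in>carrier L. \<forall>y\<in>carrier L. (x \<sqinter>\<^bsub>L\<^esub> y) \<sqinter>\<^bsub>L\<^esub> (\<sim>\<^bsub>L\<^esub> x \<sqinter>\<^bsub>L\<^esub> y) = \<zero>\<^bsub>L\<^esub>) \<and>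
    (\<forall>x\<in>carrier L. \<forall>y\<in>carrier L. \<forall>z\<in>carrier L.
      (((x \<sqinter>\<^bsub>L\<^esub> \<sim>\<^bsub>L\<^esub> y) \<squnion>\<^bsub>L\<^esub> z) \<squnion>\<^bsub>L\<^esub> (y \<squnion>\<^bsub>L\<^esub> z)) \<sqinter>\<^bsub>L\<^esub> ((x \<sqinter>\<^bsub>L\<^esub> \<sim>\<^bsub>L\<^esub> y) \<squnion>\<^bsub>L\<^esub> y)
        = (x \<sqinter>\<^bsub>L\<^esub> \<sim>\<^bsub>L\<^esub> y) \<squnion>\<^bsub>L\<^esub> y) \<and>
    (\<forall>x\<in>carrier L. \<forall>y\<in>carrier L. \<forall>z\<in>carrier L.
      ((\<sim>\<^bsub>L\<^esub> (x \<sqinter>\<^bsub>L\<^esub> y) \<sqinter>\<^bsub>L\<^esub> z) \<sqinter>\<^bsub>L\<^esub> (y \<sqinter>\<^bsub>L\<^esub> z)) \<squnion>\<^bsub>L\<^esub> (\<sim>\<^bsub>L\<^esub> (x \<sqinter>\<^bsub>L\<^esub> y) \<sqinter>\<^bsub>L\<^esub> y)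
        = \<sim>\<^bsub>L\<^esub> (x \<sqinter>\<^bsub>L\<^esub> y) \<sqinter>\<^bsub>L\<^esub> y) \<and>
    (\<forall>x\<in>carrier L. \<forall>y\<in>carrier L.
      x \<squnion>\<^bsub>L\<^esub> (\<sim>\<^bsub>L\<^esub> x \<sqinter>\<^bsub>L\<^esub> (x \<squnion>\<^bsub>L\<^esub> y)) = x \<squnion>\<^bsub>L\<^esub> y)"

section \<open>Bounded posets with operations that pick common upper and lower bounds\<close>

text \<open>\<open>Upper\<close> ignores members of its set argument that lie outside the carrier,
  hence the two carrier hypotheses; likewise for \<open>Lower\<close> in the dual.\<close>

lemma is_join_iff:
  assumes "x \<in> carrier P" "y \<in> carrier P"
  shows "is_join P s x y \<longleftrightarrow> s \<in> carrier P \<and> x \<sqsubseteq>\<^bsub>P\<^esub> s \<and> y \<sqsubseteq>\<^bsub>P\<^esub> s \<and>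
    (\<forall>z\<in>carrier P. x \<sqsubseteq>\<^bsub>P\<^esub> z \<longrightarrow> y \<sqsubseteq>\<^bsub>P\<^esub> z \<longrightarrow> s \<sqsubseteq>\<^bsub>P\<^esub> z)"
  using assms unfolding is_join_def least_def Upper_def by blast

lemma is_meet_iff:
  assumes "x \<in> carrier P" "y \<in> carrier P"
  shows "is_meet P m x y \<longleftrightarrow> m \<in> carrier P \<and> m \<sqsubseteq>\<^bsub>P\<^esub> x \<and> m \<sqsubseteq>\<^bsub>P\<^esub> y \<and>
    (\<forall>z\<in>carrier P. z \<sqsubseteq>\<^bsub>P\<^esub> x \<longrightarrow> z \<sqsubseteq>\<^bsub>P\<^esub> y \<longrightarrow> z \<sqsubseteq>\<^bsub>P\<^esub> m)"
  using assms unfolding is_meet_def greatest_def Lower_def by blast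

lemma (in bounded_uposet)
  shows pzero_closed: "pzero P \<in> carrier P" and pone_closed: "pone P \<in> carrier P"
    and pzero_le: "x \<in> carrier P \<Longrightarrow> pzero P \<sqsubseteq> x" and le_pone: "x \<in> carrier P \<Longrightarrow> x \<sqsubseteq> pone P"
  using pzero_least pone_greatest unfolding least_def greatest_def by blast+

text \<open>A common generalization of a \<open>\<lambda>\<close>-lattice assigned to \<open>P\<close> and a \<open>\<lambda>\<close>-lattice inducing \<open>P\<close>.\<close>

locale directoid_operations = bounded_uposet P
  for P :: "('a, 'n) uposet_scheme" +
  fixes L :: "('a, 'm) ulattice_scheme" (structure)
  assumes carrier_L: "carrier L = carrier P"
    and compl_L: "x \<in> carrier P \<Longrightarrow> \<sim> x = pcompl P x"
    and zero_L: "\<zero> = pzero P"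
    and one_L: "\<one> = pone P"
    and join_closed: "\<lbrakk>x \<in> carrier P; y \<in> carrier P\<rbrakk> \<Longrightarrow> x \<squnion> y \<in> carrier P"
    and meet_closed: "\<lbrakk>x \<in> carrier P; y \<in> carrier P\<rbrakk> \<Longrightarrow> x \<sqinter> y \<in> carrier P"
    and join_comm: "\<lbrakk>x \<in> carrier P; y \<in> carrier P\<rbrakk> \<Longrightarrow> x \<squnion> y = y \<squnion> x"
    and meet_comm: "\<lbrakk>x \<in> carrier P; y \<in> carrier P\<rbrakk> \<Longrightarrow> x \<sqinter> y = y \<sqinter> x"
    and join_ge1: "\<lbrakk>x \<in> carrier P; y \<in> carrier P\<rbrakk> \<Longrightarrow> x \<sqsubseteq>\<^bsub>P\<^esub> x \<squnion> y"
    and meet_le1: "\<lbrakk>x \<in> carrier P; y \<in> carrier P\<rbrakk> \<Longrightarrow> x \<sqinter> y \<sqsubseteq>\<^bsub>P\<^esub> x"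
    and join_of_le: "\<lbrakk>x \<in> carrier P; y \<in> carrier P; x \<sqsubseteq>\<^bsub>P\<^esub> y\<rbrakk> \<Longrightarrow> x \<squnion> y = y"
    and meet_of_le: "\<lbrakk>x \<in> carrier P; y \<in> carrier P; x \<sqsubseteq>\<^bsub>P\<^esub> y\<rbrakk> \<Longrightarrow> x \<sqinter> y = x"
begin

lemma join_ge2: "\<lbrakk>x \<in> carrier P; y \<in> carrier P\<rbrakk> \<Longrightarrow> y \<sqsubseteq>\<^bsub>P\<^esub> x \<squnion> y"
  by (metis join_comm join_ge1)

lemma meet_le2: "\<lbrakk>x \<in> carrier P; y \<in> carrier P\<rbrakk> \<Longrightarrow> x \<sqinter> y \<sqsubseteq>\<^bsub>P\<^esub> y"
  by (metis meet_comm meet_le1)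

lemma le_join1:
  assumes "x \<sqsubseteq>\<^bsub>P\<^esub> y" "x \<in> carrier P" "y \<in> carrier P" "z \<in> carrier P"
  shows "x \<sqsubseteq>\<^bsub>P\<^esub> y \<squnion> z"
  using assms join_ge1 join_closed le_trans by blast

lemma le_join2:
  assumes "x \<sqsubseteq>\<^bsub>P\<^esub> z" "x \<in> carrier P" "y \<in> carrier P" "z \<in> carrier P"
  shows "x \<sqsubseteq>\<^bsub>P\<^esub> y \<squnion> z"
  using assms join_ge2 join_closed le_trans by blast

lemma meet_le_of_le1:
  assumes "y \<sqsubseteq>\<^bsub>P\<^esub> x" "x \<in> carrier P" "y \<in> carrier P" "z \<in> carrier P"
  shows "y \<sqinter> z \<sqsubseteq>\<^bsub>P\<^esub> x"
  using assms meet_le1 meet_closed le_trans by blast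

lemma meet_le_of_le2:
  assumes "z \<sqsubseteq>\<^bsub>P\<^esub> x" "x \<in> carrier P" "y \<in> carrier P" "z \<in> carrier P"
  shows "y \<sqinter> z \<sqsubseteq>\<^bsub>P\<^esub> x"
  using assms meet_le2 meet_closed le_trans by blast

lemma join_of_ge: "\<lbrakk>x \<in> carrier P; y \<in> carrier P; y \<sqsubseteq>\<^bsub>P\<^esub> x\<rbrakk> \<Longrightarrow> x \<squnion> y = x"
  by (metis join_comm join_of_le)

lemma meet_of_ge: "\<lbrakk>x \<in> carrier P; y \<in> carrier P; y \<sqsubseteq>\<^bsub>P\<^esub> x\<rbrakk> \<Longrightarrow> x \<sqinter> y = y"
  by (metis meet_comm meet_of_le)

lemma is_join_unique:
  "\<lbrakk>x \<in> carrier P; y \<in> carrier P; is_join P s x y; is_join P t x y\<rbrakk> \<Longrightarrow> s = t"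
  unfolding is_join_def by (rule least_unique)

lemma is_meet_unique:
  "\<lbrakk>x \<in> carrier P; y \<in> carrier P; is_meet P s x y; is_meet P t x y\<rbrakk> \<Longrightarrow> s = t"
  unfolding is_meet_def by (rule greatest_unique)

lemmas operation_closed =
  join_closed meet_closed pcompl_closed pzero_closed pone_closed

section \<open>Skew-orthomodularity and the five identities\<close>

text \<open>Agreement is required only at pairs whose join or meet must exist in a skew-orthomodular
  poset. It is automatic for assigned \<lambda>-lattices and is the compatibility condition for
  induced posets, so one equivalence serves both claims.\<close>

definition orthogonal_agreement :: bool where
  "orthogonal_agreement \<longleftrightarrow>
    (\<forall>x\<in>carrier P. \<forall>y\<in>carrier P. \<forall>s. x \<sqsubseteq>\<^bsub>P\<^esub> pcompl P y \<longrightarrow> is_join P s x y \<longrightarrow> x \<squnion> y = s) \<and>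
    (\<forall>x\<in>carrier P. \<forall>y\<in>carrier P. \<forall>m. x \<sqsubseteq>\<^bsub>P\<^esub> y \<longrightarrow> is_meet P m (pcompl P x) y \<longrightarrow>
      pcompl P x \<sqinter> y = m)"

text \<open>By agreement the operations give true joins and meets at orthogonal pairs. Identities 1
  and 2 hold since a nested \<open>\<squnion>\<close> bounds all its arguments from above, and
  dually; 3 and 4 compare a join or meet with another bound; 5 is the skew-orthomodular law at
  \<open>x \<le> x \<squnion> y\<close>, where \<open>x \<squnion> y\<close> need not be the
  join.\<close>

lemma identities_if_skew_orthomodular:
  assumes "skew_orthomodular_uposet P" and agree: orthogonal_agreement
  shows "skew_orthomodular_identities L"
proof -
  interpret S: skew_orthomodular_uposet P by fact
  have orth_join: "is_join P (x \<squnion> y) x y"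
    if xy: "x \<in> carrier P" "y \<in> carrier P" "x \<sqsubseteq>\<^bsub>P\<^esub> pcompl P y" for x y
  proof -
    obtain s where s: "is_join P s x y" using S.orthogonal_join[OF xy] by blast
    with xy agree have "x \<squnion> y = s" by (simp add: orthogonal_agreement_def)
    with s show ?thesis by simp
  qed
  have orth_meet: "is_meet P (pcompl P x \<sqinter> y) (pcompl P x) y"
    if xy: "x \<in> carrier P" "y \<in> carrier P" "x \<sqsubseteq>\<^bsub>P\<^esub> y" for x y
  proof -
    obtain m where m: "is_meet P m (pcompl P x) y"
      using S.almost_skew_orthomodular[OF xy] by blast
    with xy agree have "pcompl P x \<sqinter> y = m" by (simp add: orthogonal_agreement_def)
    with m show ?thesis by simp
  qed
  have 1: "(x \<squnion> y) \<squnion> (\<sim> x \<squnion> y) = \<one>" if [simp]: "x \<in> carrier P" "y \<in> carrier P" for x y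
  proof -
    let ?j = "(x \<squnion> y) \<squnion> (pcompl P x \<squnion> y)"
    have "x \<sqsubseteq>\<^bsub>P\<^esub> ?j" "pcompl P x \<sqsubseteq>\<^bsub>P\<^esub> ?j"
      by (simp_all add: le_join1 le_join2 join_ge1 operation_closed)
    then have "pone P \<sqsubseteq>\<^bsub>P\<^esub> ?j"
      using S.join_compl[of x] by (simp add: is_join_iff operation_closed)
    then have "?j = pone P"
      by (intro le_antisym) (simp_all add: operation_closed le_pone)
    then show ?thesis by (simp add: compl_L one_L)
  qed
  have 2: "(x \<sqinter> y) \<sqinter> (\<sim> x \<sqinter> y) = \<zero>" if [simp]: "x \<in> carrier P" "y \<in> carrier P" for x y
  proof -
    let ?m = "(x \<sqinter> y) \<sqinter> (pcompl P x \<sqinter> y)"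
    have "?m \<sqsubseteq>\<^bsub>P\<^esub> x" "?m \<sqsubseteq>\<^bsub>P\<^esub> pcompl P x"
      by (simp_all add: meet_le_of_le1 meet_le_of_le2 meet_le1 operation_closed)
    then have "?m \<sqsubseteq>\<^bsub>P\<^esub> pzero P"
      using S.meet_compl[of x] by (simp add: is_meet_iff operation_closed)
    then have "?m = pzero P"
      by (intro le_antisym) (simp_all add: operation_closed pzero_le)
    then show ?thesis by (simp add: compl_L zero_L)
  qed
  have 3: "(((x \<sqinter> \<sim> y) \<squnion> z) \<squnion> (y \<squnion> z)) \<sqinter> ((x \<sqinter> \<sim> y) \<squnion> y) = (x \<sqinter> \<sim> y) \<squnion> y"
    if [simp]: "x \<in> carrier P" "y \<in> carrier P" "z \<in> carrier P" for x y z
  proof -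
    \<comment> \<open>\<open>w\<close> stands for a general element below \<open>y'\<close>, so
      orthogonality applies to \<open>w, y\<close> with no hypothesis on \<open>x\<close>.\<close>
    define w where "w = x \<sqinter> pcompl P y"
    have [simp]: "w \<in> carrier P" by (simp add: w_def operation_closed)
    have "is_join P (w \<squnion> y) w y"
      by (rule orth_join) (simp_all add: w_def meet_le2 operation_closed)
    moreover have "w \<sqsubseteq>\<^bsub>P\<^esub> (w \<squnion> z) \<squnion> (y \<squnion> z)" "y \<sqsubseteq>\<^bsub>P\<^esub> (w \<squnion> z) \<squnion> (y \<squnion> z)"
      by (simp_all add: le_join1 le_join2 join_ge1 operation_closed)
    ultimately have "w \<squnion> y \<sqsubseteq>\<^bsub>P\<^esub> (w \<squnion> z) \<squnion> (y \<squnion> z)"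
      by (simp add: is_join_iff operation_closed)
    then show ?thesis by (simp add: compl_L meet_of_ge operation_closed flip: w_def)
  qed
  have 4: "((\<sim> (x \<sqinter> y) \<sqinter> z) \<sqinter> (y \<sqinter> z)) \<squnion> (\<sim> (x \<sqinter> y) \<sqinter> y) = \<sim> (x \<sqinter> y) \<sqinter> y"
    if [simp]: "x \<in> carrier P" "y \<in> carrier P" "z \<in> carrier P" for x y z
  proof -
    define w where "w = pcompl P (x \<sqinter> y)"
    have [simp]: "w \<in> carrier P" by (simp add: w_def operation_closed)
    have "is_meet P (w \<sqinter> y) w y"
      \<comment> \<open>\<open>orth_meet\<close> is applied to
        \<open>x \<sqinter> y \<le> y\<close>, which yields the meet of
        \<open>(x \<sqinter> y)'\<close> and \<open>y\<close>.\<close>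
      unfolding w_def by (rule orth_meet) (simp_all add: meet_le2 operation_closed)
    moreover have "(w \<sqinter> z) \<sqinter> (y \<sqinter> z) \<sqsubseteq>\<^bsub>P\<^esub> w" "(w \<sqinter> z) \<sqinter> (y \<sqinter> z) \<sqsubseteq>\<^bsub>P\<^esub> y"
      by (simp_all add: meet_le_of_le1 meet_le_of_le2 meet_le1 operation_closed)
    ultimately have "(w \<sqinter> z) \<sqinter> (y \<sqinter> z) \<sqsubseteq>\<^bsub>P\<^esub> w \<sqinter> y"
      by (simp add: is_meet_iff operation_closed)
    then show ?thesis by (simp add: compl_L join_of_le operation_closed flip: w_def)
  qed
  have 5: "x \<squnion> (\<sim> x \<sqinter> (x \<squnion> y)) = x \<squnion> y"
    if [simp]: "x \<in> carrier P" "y \<in> carrier P" for x y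
  proof -
    define m where "m = pcompl P x \<sqinter> (x \<squnion> y)"
    have [simp]: "m \<in> carrier P" by (simp add: m_def operation_closed)
    have meet: "is_meet P m (pcompl P x) (x \<squnion> y)"
      unfolding m_def by (rule orth_meet) (simp_all add: join_ge1 operation_closed)
    \<comment> \<open>As the complement is not assumed antitone or involutive,
      \<open>m \<le> x'\<close> gives orthogonality in the order \<open>m, x\<close> only;
      commutativity then swaps the arguments.\<close>
    have "is_join P (m \<squnion> x) m x"
      by (rule orth_join) (simp_all add: m_def meet_le1 operation_closed)
    then have join: "is_join P (x \<squnion> m) x m"
      by (simp add: is_join_def insert_commute join_comm[of x m])
    have "x \<squnion> m = x \<squnion> y"
      by (rule S.skew_orthomodular[OF _ _ _ meet join]) (simp_all add: join_ge1 operation_closed)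
    then show ?thesis by (simp add: compl_L m_def)
  qed
  show ?thesis
    unfolding skew_orthomodular_identities_def carrier_L by (intro conjI ballI 1 2 3 4 5)
qed

text \<open>Identities 1 and 2 give complements. Identity 3 makes \<open>\<squnion>\<close> the join
  at orthogonal pairs and 4 makes \<open>\<sqinter>\<close> the meet of \<open>x'\<close> and
  \<open>y\<close> for \<open>x \<le> y\<close>; these yield orthogonality, the almost skew
  condition and agreement. Identity 5 then gives the skew-orthomodular law.\<close>

lemma skew_orthomodular_if_identities:
  assumes "skew_orthomodular_identities L"
  shows "skew_orthomodular_uposet P" and orthogonal_agreement
proof -
  have ids:
    "\<And>x y. \<lbrakk>x \<in> carrier P; y \<in> carrier P\<rbrakk> \<Longrightarrow> (x \<squnion> y) \<squnion> (pcompl P x \<squnion> y) = pone P"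
    "\<And>x y. \<lbrakk>x \<in> carrier P; y \<in> carrier P\<rbrakk> \<Longrightarrow> (x \<sqinter> y) \<sqinter> (pcompl P x \<sqinter> y) = pzero P"
    "\<And>x y z. \<lbrakk>x \<in> carrier P; y \<in> carrier P; z \<in> carrier P\<rbrakk> \<Longrightarrow>
      (((x \<sqinter> pcompl P y) \<squnion> z) \<squnion> (y \<squnion> z)) \<sqinter> ((x \<sqinter> pcompl P y) \<squnion> y) = (x \<sqinter> pcompl P y) \<squnion> y"
    "\<And>x y z. \<lbrakk>x \<in> carrier P; y \<in> carrier P; z \<in> carrier P\<rbrakk> \<Longrightarrow>
      ((pcompl P (x \<sqinter> y) \<sqinter> z) \<sqinter> (y \<sqinter> z)) \<squnion> (pcompl P (x \<sqinter> y) \<sqinter> y) = pcompl P (x \<sqinter> y) \<sqinter> y"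
    "\<And>x y. \<lbrakk>x \<in> carrier P; y \<in> carrier P\<rbrakk> \<Longrightarrow> x \<squnion> (pcompl P x \<sqinter> (x \<squnion> y)) = x \<squnion> y"
    using assms
    by (simp_all add: skew_orthomodular_identities_def carrier_L compl_L one_L zero_L
        operation_closed)
  have orth_join: "is_join P (x \<squnion> y) x y"
    if [simp]: "x \<in> carrier P" "y \<in> carrier P" and le: "x \<sqsubseteq>\<^bsub>P\<^esub> pcompl P y" for x y
  proof -
    have "x \<squnion> y \<sqsubseteq>\<^bsub>P\<^esub> z" if [simp]: "z \<in> carrier P" and "x \<sqsubseteq>\<^bsub>P\<^esub> z" "y \<sqsubseteq>\<^bsub>P\<^esub> z" for z
    proof -
      \<comment> \<open>Here \<open>x \<sqinter> y' = x\<close>, and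
        \<open>x \<squnion> z = y \<squnion> z = z\<close>, so identity 3 collapses to this
        equation.\<close>
      have "z \<sqinter> (x \<squnion> y) = x \<squnion> y"
        using ids(3)[of x y z] le that by (simp add: meet_of_le join_of_le operation_closed)
      then show ?thesis using meet_le1[of z "x \<squnion> y"] by (simp add: operation_closed)
    qed
    then show ?thesis by (simp add: is_join_iff operation_closed join_ge1 join_ge2)
  qed
  have orth_meet: "is_meet P (pcompl P x \<sqinter> y) (pcompl P x) y"
    if [simp]: "x \<in> carrier P" "y \<in> carrier P" and le: "x \<sqsubseteq>\<^bsub>P\<^esub> y" for x y
  proof -
    have "z \<sqsubseteq>\<^bsub>P\<^esub> pcompl P x \<sqinter> y"
      if [simp]: "z \<in> carrier P" and "z \<sqsubseteq>\<^bsub>P\<^esub> pcompl P x" "z \<sqsubseteq>\<^bsub>P\<^esub> y" for z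
    proof -
      \<comment> \<open>Dually, \<open>x \<sqinter> y = x\<close> and
        \<open>x' \<sqinter> z = y \<sqinter> z = z\<close> collapse identity 4.\<close>
      have "z \<squnion> (pcompl P x \<sqinter> y) = pcompl P x \<sqinter> y"
        using ids(4)[of x y z] le that
        by (simp add: meet_of_le meet_of_ge operation_closed)
      then show ?thesis
        using join_ge1[of z "pcompl P x \<sqinter> y"] by (simp add: operation_closed)
    qed
    then show ?thesis by (simp add: is_meet_iff operation_closed meet_le1 meet_le2)
  qed
  have orth_join': "is_join P (x \<squnion> m) x m"
    if "x \<in> carrier P" "m \<in> carrier P" "m \<sqsubseteq>\<^bsub>P\<^esub> pcompl P x" for x m
    using orth_join[of m x] that
    by (simp add: is_join_def insert_commute join_comm[of x m])
  have meet_unique: "m = pcompl P x \<sqinter> y"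
    if "x \<in> carrier P" "y \<in> carrier P" "x \<sqsubseteq>\<^bsub>P\<^esub> y" "is_meet P m (pcompl P x) y" for x y m
    using that by (intro is_meet_unique[OF _ _ _ orth_meet]) (simp_all add: pcompl_closed)
  show orthogonal_agreement
    unfolding orthogonal_agreement_def
    using orth_join meet_unique is_join_unique by metis
  show "skew_orthomodular_uposet P"
  proof
    fix x assume [simp]: "x \<in> carrier P"
    \<comment> \<open>For a common upper bound \<open>z\<close> the left side of identity 1 reduces
      to \<open>z \<squnion> z = z\<close>, so 1 is the only such bound.\<close>
    have "z = pone P" if "z \<in> carrier P" "x \<sqsubseteq>\<^bsub>P\<^esub> z" "pcompl P x \<sqsubseteq>\<^bsub>P\<^esub> z" for z
      using ids(1)[of x z] that by (simp add: join_of_le operation_closed)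
    then show "is_join P (pone P) x (pcompl P x)"
      by (auto simp: is_join_iff operation_closed le_pone)
    have "z = pzero P" if "z \<in> carrier P" "z \<sqsubseteq>\<^bsub>P\<^esub> x" "z \<sqsubseteq>\<^bsub>P\<^esub> pcompl P x" for z
      using ids(2)[of x z] that by (simp add: meet_of_le meet_of_ge operation_closed)
    then show "is_meet P (pzero P) x (pcompl P x)"
      by (auto simp: is_meet_iff operation_closed pzero_le)
  next
    show "\<exists>s. is_join P s x y"
      if "x \<in> carrier P" "y \<in> carrier P" "x \<sqsubseteq>\<^bsub>P\<^esub> pcompl P y" for x y
      using orth_join that by blast
  next
    fix x y assume xy: "x \<in> carrier P" "y \<in> carrier P" "x \<sqsubseteq>\<^bsub>P\<^esub> y"
    \<comment> \<open>The join exists by orthogonality alone, because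
      \<open>x' \<sqinter> y \<le> x'\<close>.\<close>
    then have join: "is_join P (x \<squnion> (pcompl P x \<sqinter> y)) x (pcompl P x \<sqinter> y)"
      by (intro orth_join') (simp_all add: operation_closed meet_le1)
    then show "\<exists>m. is_meet P m (pcompl P x) y \<and> (\<exists>s. is_join P s x m)"
      using orth_meet[OF xy] by blast
    fix m s assume "is_meet P m (pcompl P x) y" and s: "is_join P s x m"
    then have m: "m = pcompl P x \<sqinter> y" using meet_unique xy by blast
    have "s = x \<squnion> m"
      using s join xy unfolding m by (intro is_join_unique) (simp_all add: operation_closed)
    \<comment> \<open>Since \<open>x \<le> y\<close>, both occurrences of
      \<open>x \<squnion> y\<close> in identity 5 are \<open>y\<close>.\<close>
    also have "\<dots> = y" using ids(5)[of x y] xy by (simp add: m join_of_le)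
    finally show "s = y" .
  qed
qed

text \<open>Agreement stands on the left because identities 3 and 4 force it, while the order alone
  does not.\<close>

lemma skew_orthomodular_iff_identities:
  "skew_orthomodular_uposet P \<and> orthogonal_agreement \<longleftrightarrow> skew_orthomodular_identities L"
  using identities_if_skew_orthomodular skew_orthomodular_if_identities by blast

end

section \<open>Lambda-lattices assigned to a bounded poset\<close>

lemma directoid_operations_assigned:
  assumes "bounded_uposet P" "assigned_lambda_lattice P L"
  shows "directoid_operations P L"
proof -
  interpret P: bounded_uposet P by fact
  interpret A: assigned_lambda_lattice P L by fact
  have join: "x \<squnion>\<^bsub>L\<^esub> y = y \<squnion>\<^bsub>L\<^esub> x \<and> x \<squnion>\<^bsub>L\<^esub> y \<in> Upper P {x, y}"
    if "x \<in> carrier P" "y \<in> carrier P" for x y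
  \<comment> \<open>An existing join is symmetric in its arguments and is the value in both orders;
    otherwise the choice clause supplies a symmetric upper bound.\<close>
  proof (cases "\<exists>s. is_join P s x y")
    case True
    then obtain s where s: "is_join P s x y" by blast
    then have "is_join P s y x" by (simp add: is_join_def insert_commute)
    then show ?thesis
      using s that A.ljoin_exists[of x y s] A.ljoin_exists[of y x s]
      by (simp add: is_join_def least_def)
  qed (use that A.ljoin_choice in blast)
  have meet: "x \<sqinter>\<^bsub>L\<^esub> y = y \<sqinter>\<^bsub>L\<^esub> x \<and> x \<sqinter>\<^bsub>L\<^esub> y \<in> Lower P {x, y}"
    if "x \<in> carrier P" "y \<in> carrier P" for x y
  proof (cases "\<exists>m. is_meet P m x y")
    case True
    then obtain m where m: "is_meet P m x y" by blast
    then have "is_meet P m y x" by (simp add: is_meet_def insert_commute)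
    then show ?thesis
      using m that A.lmeet_exists[of x y m] A.lmeet_exists[of y x m]
      by (simp add: is_meet_def greatest_def)
  qed (use that A.lmeet_choice in blast)
  show ?thesis
  proof
    fix x y assume xy: "x \<in> carrier P" "y \<in> carrier P"
    show "x \<squnion>\<^bsub>L\<^esub> y \<in> carrier P" "x \<squnion>\<^bsub>L\<^esub> y = y \<squnion>\<^bsub>L\<^esub> x" "x \<sqsubseteq>\<^bsub>P\<^esub> x \<squnion>\<^bsub>L\<^esub> y"
      using join[OF xy] xy by (auto simp: Upper_def)
    show "x \<sqinter>\<^bsub>L\<^esub> y \<in> carrier P" "x \<sqinter>\<^bsub>L\<^esub> y = y \<sqinter>\<^bsub>L\<^esub> x" "x \<sqinter>\<^bsub>L\<^esub> y \<sqsubseteq>\<^bsub>P\<^esub> x"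
      using meet[OF xy] xy by (auto simp: Lower_def)
    assume "x \<sqsubseteq>\<^bsub>P\<^esub> y"
    \<comment> \<open>Comparable elements have a join and a meet, so no arbitrary choice enters
      here.\<close>
    then show "x \<squnion>\<^bsub>L\<^esub> y = y" "x \<sqinter>\<^bsub>L\<^esub> y = x"
      using xy by (auto intro!: A.ljoin_exists A.lmeet_exists simp: is_join_iff is_meet_iff)
  qed (simp_all add: A.carrier_eq A.lcompl_eq A.lzero_eq A.lone_eq)
qed

lemma orthogonal_agreement_assigned:
  assumes "bounded_uposet P" "assigned_lambda_lattice P L"
  shows "directoid_operations.orthogonal_agreement P L"
proof -
  interpret A: assigned_lambda_lattice P L by fact
  interpret directoid_operations P L by (rule directoid_operations_assigned) fact+
  show ?thesis
    unfolding orthogonal_agreement_def using A.ljoin_exists A.lmeet_exists pcompl_closed by blast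
qed

section \<open>Bounded \<lambda>-lattices and their induced posets\<close>

lemma induced_uposet_simps [simp]:
  "carrier (induced_uposet L) = carrier L"
  "x \<sqsubseteq>\<^bsub>induced_uposet L\<^esub> y \<longleftrightarrow> x \<squnion>\<^bsub>L\<^esub> y = y"
  "x .=\<^bsub>induced_uposet L\<^esub> y \<longleftrightarrow> x = y"
  "pcompl (induced_uposet L) = lcompl L"
  "pzero (induced_uposet L) = \<zero>\<^bsub>L\<^esub>"
  "pone (induced_uposet L) = \<one>\<^bsub>L\<^esub>"
  by (simp_all add: induced_uposet_def)

context bounded_lambda_ulattice
begin

text \<open>Two absorptions: \<open>x = x \<squnion> (x \<sqinter> (x \<squnion> x)) = x \<squnion>
  x\<close>.\<close>

lemma ljoin_idem: "x \<in> carrier L \<Longrightarrow> x \<squnion> x = x"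
  by (metis ljoin_absorb lmeet_absorb ljoin_closed)

text \<open>Skew associativity is exactly strong enough to replace associativity: with
  \<open>x \<squnion> y = y\<close> it reads
  \<open>x \<squnion> (y \<squnion> z) = y \<squnion> z\<close>.\<close>

lemma ljoin_trans:
  assumes "x \<in> carrier L" "y \<in> carrier L" "z \<in> carrier L" "x \<squnion> y = y" "y \<squnion> z = z"
  shows "x \<squnion> z = z"
  using ljoin_skew_assoc[of x y z] assms by simp

lemma bounded_uposet_induced: "bounded_uposet (induced_uposet L)"
proof
  show "least (induced_uposet L) (pzero (induced_uposet L)) (carrier (induced_uposet L))"
    by (auto simp: least_def lzero_closed ljoin_lzero ljoin_comm[of \<zero>])
  show "greatest (induced_uposet L) (pone (induced_uposet L)) (carrier (induced_uposet L))"
    by (auto simp: greatest_def lone_closed ljoin_lone)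
  show "(.=\<^bsub>induced_uposet L\<^esub>) = (=)" by (simp add: induced_uposet_def)
qed (auto simp: ljoin_idem lcompl_closed dest: ljoin_comm intro: ljoin_trans)

lemma directoid_operations_induced: "directoid_operations (induced_uposet L) L"
proof -
  interpret I: bounded_uposet "induced_uposet L" by (rule bounded_uposet_induced)
  show ?thesis
  proof
    fix x y assume "x \<in> carrier (induced_uposet L)" "y \<in> carrier (induced_uposet L)"
    then have xy: "x \<in> carrier L" "y \<in> carrier L" by simp_all
    show "x \<squnion> y = y \<squnion> x" "x \<sqinter> y = y \<sqinter> x"
      using xy ljoin_comm lmeet_comm by blast+
    \<comment> \<open>Absorption gives \<open>x = (x \<squnion> y) \<sqinter> x\<close>, and
      \<open>x \<squnion> y\<close> absorbs its own meet with \<open>x\<close>.\<close>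
    show "x \<sqsubseteq>\<^bsub>induced_uposet L\<^esub> x \<squnion> y"
      using xy
      by (metis induced_uposet_simps(2) ljoin_closed ljoin_comm ljoin_absorb lmeet_absorb lmeet_comm)
    show "x \<sqinter> y \<sqsubseteq>\<^bsub>induced_uposet L\<^esub> x"
      using xy by (metis induced_uposet_simps(2) lmeet_closed ljoin_comm ljoin_absorb)
    assume "x \<sqsubseteq>\<^bsub>induced_uposet L\<^esub> y"
    then show "x \<squnion> y = y" "x \<sqinter> y = x"
      using xy lmeet_absorb[of x y] by simp_all
  qed (simp_all add: ljoin_closed lmeet_closed)
qed

text \<open>For the induced poset \<open>orthogonally_compatible\<close> unfolds to
  \<open>orthogonal_agreement\<close>, so the general equivalence applies.\<close>

lemma induced_skew_orthomodular_iff_identities: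
  "skew_orthomodular_uposet (induced_uposet L) \<and> orthogonally_compatible L \<longleftrightarrow>
    skew_orthomodular_identities L"
proof -
  interpret directoid_operations "induced_uposet L" L by (rule directoid_operations_induced)
  have "orthogonally_compatible L \<longleftrightarrow> orthogonal_agreement"
    unfolding orthogonally_compatible_def orthogonal_agreement_def induced_uposet_simps by blast
  then show ?thesis using skew_orthomodular_iff_identities by simp
qed

end

section \<open>Equations between terms and the variety\<close>

abbreviation (input) "tx \<equiv> Var 0"
abbreviation (input) "ty \<equiv> Var 1"
abbreviation (input) "tz \<equiv> Var 2"

definition lambda_lattice_equations :: "(uterm \<times> uterm) set" where
  "lambda_lattice_equations =
    {(Join tx ty, Join ty tx),
     (Meet tx ty, Meet ty tx),
     (Join tx (Join (Join tx ty) tz), Join (Join tx ty) tz),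
     (Meet tx (Meet (Meet tx ty) tz), Meet (Meet tx ty) tz),
     (Join tx (Meet tx ty), tx),
     (Meet tx (Join tx ty), tx),
     (Join tx Zero, tx),
     (Join tx One, One)}"

definition skew_orthomodular_equations :: "(uterm \<times> uterm) set" where
  "skew_orthomodular_equations =
    (let s = Meet tx (Compl ty); t = Compl (Meet tx ty) in
    {(Join (Join tx ty) (Join (Compl tx) ty), One),
     (Meet (Meet tx ty) (Meet (Compl tx) ty), Zero),
     (Meet (Join (Join s tz) (Join ty tz)) (Join s ty), Join s ty),
     (Join (Meet (Meet t tz) (Meet ty tz)) (Meet t ty), Meet t ty),
     (Join tx (Meet (Compl tx) (Join tx ty)), Join tx ty)})"

text \<open>The equations use only variables 0, 1 and 2. All further variables also get
  \<open>z\<close>, which keeps the range inside the carrier.\<close>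

definition valuation :: "'a \<Rightarrow> 'a \<Rightarrow> 'a \<Rightarrow> nat \<Rightarrow> 'a" where
  "valuation x y z i = (if i = 0 then x else if i = 1 then y else z)"

text \<open>Index 1 appears as \<open>Suc 0\<close>, its simplifier normal form.\<close>

lemma valuation_simps [simp]:
  "valuation x y z 0 = x" "valuation x y z (Suc 0) = y" "valuation x y z 2 = z"
  by (simp_all add: valuation_def)

lemma satisfies_identityD:
  assumes "satisfies_identity L e" "x \<in> carrier L" "y \<in> carrier L" "z \<in> carrier L"
  shows "term_val L (valuation x y z) (fst e) = term_val L (valuation x y z) (snd e)"
proof -
  have "range (valuation x y z) \<subseteq> carrier L"
    using assms by (auto simp: valuation_def)
  then show ?thesis using assms by (simp add: satisfies_identity_def)
qed

lemma satisfies_identityI: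
  assumes "\<And>v. \<forall>i. v i \<in> carrier L \<Longrightarrow> term_val L v (fst e) = term_val L v (snd e)"
  shows "satisfies_identity L e"
  using assms by (auto simp: satisfies_identity_def)

lemma bounded_lambda_ulattice_iff_equations:
  "bounded_lambda_ulattice L \<longleftrightarrow>
    ualgebra L \<and> (\<forall>e\<in>lambda_lattice_equations. satisfies_identity L e)"
proof (intro iffI conjI ballI)
  assume L: "bounded_lambda_ulattice L"
  then interpret bounded_lambda_ulattice L .
  show "ualgebra L" ..
  fix e assume "e \<in> lambda_lattice_equations"
  then show "satisfies_identity L e"
    unfolding lambda_lattice_equations_def
    by (intro satisfies_identityI)
      (auto simp: ljoin_skew_assoc lmeet_skew_assoc ljoin_absorb lmeet_absorb ljoin_lzero ljoin_lone,
        (metis ljoin_comm lmeet_comm)+)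
next
  assume L: "ualgebra L \<and> (\<forall>e\<in>lambda_lattice_equations. satisfies_identity L e)"
  then interpret ualgebra L by simp
  \<comment> \<open>Evaluating every equation at \<open>valuation x y z\<close> turns it back into
    an axiom about arbitrary carrier elements.\<close>
  have "\<forall>e\<in>lambda_lattice_equations.
      term_val L (valuation x y z) (fst e) = term_val L (valuation x y z) (snd e)"
    if "x \<in> carrier L" "y \<in> carrier L" "z \<in> carrier L" for x y z
    by (intro ballI satisfies_identityD that) (simp add: L)
  note eqs = this[unfolded lambda_lattice_equations_def, simplified]
  show "bounded_lambda_ulattice L"
    by unfold_locales (meson eqs)+
qed

lemma skew_orthomodular_identities_iff_equations:
  "skew_orthomodular_identities L \<longleftrightarrow>
    (\<forall>e\<in>skew_orthomodular_equations. satisfies_identity L e)"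
proof (intro iffI ballI)
  fix e
  assume L: "skew_orthomodular_identities L" and e: "e \<in> skew_orthomodular_equations"
  note ids = L[unfolded skew_orthomodular_identities_def]
  show "satisfies_identity L e"
    using e unfolding skew_orthomodular_equations_def Let_def
    by (intro satisfies_identityI) (elim insertE emptyE; simp add: ids)
next
  assume L: "\<forall>e\<in>skew_orthomodular_equations. satisfies_identity L e"
  have "\<forall>e\<in>skew_orthomodular_equations.
      term_val L (valuation x y z) (fst e) = term_val L (valuation x y z) (snd e)"
    if "x \<in> carrier L" "y \<in> carrier L" "z \<in> carrier L" for x y z
    by (intro ballI satisfies_identityD that) (simp add: L)
  note eqs = this[unfolded skew_orthomodular_equations_def Let_def, simplified]
  show "skew_orthomodular_identities L"
    unfolding skew_orthomodular_identities_def by (intro conjI ballI) (meson eqs)+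
qed

text \<open>\<open>uterm\<close> has no type parameter, so the same set of equations defines the
  class at every carrier type.\<close>

lemma skew_orthomodular_lambda_lattices_eq_models:
  "skew_orthomodular_lambda_lattices =
    models (lambda_lattice_equations \<union> skew_orthomodular_equations)"
proof -
  have "L \<in> skew_orthomodular_lambda_lattices \<longleftrightarrow>
      bounded_lambda_ulattice L \<and> skew_orthomodular_identities L" for L :: "'a ulattice"
    unfolding skew_orthomodular_lambda_lattices_def
    using bounded_lambda_ulattice.induced_skew_orthomodular_iff_identities by blast
  then show ?thesis
    by (auto simp: models_def bounded_lambda_ulattice_iff_equations
        skew_orthomodular_identities_iff_equations)
qed

theorem corollary7:
  fixes L :: "('a, 'm) ulattice_scheme" (structure)
    and P :: "('a, 'n) uposet_scheme"
  shows "(bounded_uposet P \<and> assigned_lambda_lattice P L \<longrightarrow>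
      (skew_orthomodular_uposet P \<longleftrightarrow>
        (\<forall>x\<in>carrier L. \<forall>y\<in>carrier L. (x \<squnion> y) \<squnion> (\<sim> x \<squnion> y) = \<one>) \<and>
        (\<forall>x\<in>carrier L. \<forall>y\<in>carrier L. (x \<sqinter> y) \<sqinter> (\<sim> x \<sqinter> y) = \<zero>) \<and>
        (\<forall>x\<in>carrier L. \<forall>y\<in>carrier L. \<forall>z\<in>carrier L.
          (((x \<sqinter> \<sim> y) \<squnion> z) \<squnion> (y \<squnion> z)) \<sqinter> ((x \<sqinter> \<sim> y) \<squnion> y) = (x \<sqinter> \<sim> y) \<squnion> y) \<and>
        (\<forall>x\<in>carrier L. \<forall>y\<in>carrier L. \<forall>z\<in>carrier L.
          ((\<sim> (x \<sqinter> y) \<sqinter> z) \<sqinter> (y \<sqinter> z)) \<squnion> (\<sim> (x \<sqinter> y) \<sqinter> y) = \<sim> (x \<sqinter> y) \<sqinter> y) \<and>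
        (\<forall>x\<in>carrier L. \<forall>y\<in>carrier L. x \<squnion> (\<sim> x \<sqinter> (x \<squnion> y)) = x \<squnion> y)))
    \<and> variety (skew_orthomodular_lambda_lattices :: 'b ulattice set)
        (skew_orthomodular_lambda_lattices :: 'c ulattice set)"
proof -
  have "skew_orthomodular_uposet P \<longleftrightarrow> skew_orthomodular_identities L"
    if "bounded_uposet P" "assigned_lambda_lattice P L"
  proof -
    interpret directoid_operations P L using that by (rule directoid_operations_assigned)
    show ?thesis
      \<comment> \<open>An assigned \<lambda>-lattice satisfies agreement, so that conjunct drops
        out of the equivalence.\<close>
      using skew_orthomodular_iff_identities orthogonal_agreement_assigned[OF that] by simp
  qed
  moreover have "variety (skew_orthomodular_lambda_lattices :: 'b ulattice set)
      (skew_orthomodular_lambda_lattices :: 'c ulattice set)"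
    unfolding variety_def
    \<comment> \<open>The first conjunct fixes the set of equations; the second is the same lemma at
      the other type.\<close>
    by (intro exI conjI) (rule skew_orthomodular_lambda_lattices_eq_models)+
  ultimately show ?thesis
    unfolding skew_orthomodular_identities_def by simp
qed

end
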